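(* Let $(X,\tau,\le)$ be a separable linearly ordered topological space, let $\mu$ be a probability measure on the Borel $\sigma$-algebra of $(X,\tau)$, let $F$ be its cumulative distribution function and let $G$ be the pseudo-inverse of $F$. Suppose that $G$ is defined at every point of $[0,1]$. Then $\mu(A)=l(G^{-1}(A))$ for each $A$ in the Borel $\sigma$-algebra of $(X,\tau)$, where $l$ is the Lebesgue measure on $[0,1]$.
   Context: A linearly ordered topological space (LOTS) is a triple $(X,\tau,\le)$ where $\le$ is a linear order on $X$ and $\tau$ is the order topology, i.e. the topology with subbasis $\{\{x\in X:x<a\}:a\in X\}\cup\{\{x\in X:x>a\}:a\in X\}$. Separable means having a countable $\tau$-dense subset. The cumulative distribution function of $\mu$ is $F:X\to[0,1]$, $F(x)=\mu(\{y\in X:y\le x\})$. The pseudo-inverse of $F$ is $G(r)=\inf\{y\in X:F(y)\ge r\}$, defined exactly at those $r\in[0,1]$ for which this infimum (greatest lower bound in $X$) exists. *)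

theory Defs
  imports "HOL-Probability.Probability_Measure" "HOL-Library.Lub_Glb"
begin

definition order_cdf :: "'a::linorder_topology measure \<Rightarrow> 'a \<Rightarrow> real" where
  "order_cdf \<mu> x = measure \<mu> {y. y \<le> x}"

text \<open>
  The pseudo-inverse is a partial function on the unit interval: it has a value at \<open>r\<close> exactly
  when the set below has a greatest lower bound in the whole order, which need not be complete.
\<close>

definition pseudo_inverse :: "'a::linorder_topology measure \<Rightarrow> real \<Rightarrow> 'a option" where
  "pseudo_inverse \<mu> r =
     (if r \<in> {0..1} \<and> (\<exists>g. isGlb UNIV {y. order_cdf \<mu> y \<ge> r} g)
      then Some (THE g. isGlb UNIV {y. order_cdf \<mu> y \<ge> r} g)
      else None)"

end

theory Submission
  imports Defs
begin

text \<open>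
  Two facts carry the proof. The first is the Galois connection \<open>G r \<le> x \<longleftrightarrow> r \<le> F x\<close>, with \<open>F\<close>
  the distribution function and \<open>G\<close> its pseudo-inverse. It says that \<open>G\<close> pulls the half-line
  \<open>{..x}\<close> back to \<open>{0..F x}\<close>, whose length \<open>F x\<close> is \<open>\<mu> {..x}\<close>. So \<open>\<mu>\<close> and the image of Lebesgue
  measure under \<open>G\<close> agree on closed lower half-lines. The second is that these half-lines, which
  are closed under intersection, generate the Borel sets, so that agreement on them suffices.

  Both facts rest on the same use of separability: in a lower set without greatest element, or an
  upper set without least element, the points of a countable dense set \<open>D\<close> are cofinal or
  coinitial. Hence the limits involved are countable ones, although a separable ordered space need
  not be second countable (the double arrow space is not). For the Galois connection the point is
  that the infimum \<open>G r\<close> of \<open>{y. F y \<ge> r}\<close> belongs to that set, by continuity of \<open>\<mu>\<close> from above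
  along points of \<open>D\<close>. For the generation of Borel sets it makes every lower set, hence every
  order-convex set, a countable combination of half-lines; and an open set has only countably many
  order-convex components, as each contains a point of \<open>D\<close>.
\<close>

section \<open>Countable dense sets in a linear order\<close>

lemma separable_space_countable_dense:
  assumes "separable_space (euclidean :: 'a::topological_space topology)"
  shows "\<exists>D::'a set. countable D \<and> (\<forall>U. open U \<longrightarrow> U \<noteq> {} \<longrightarrow> (\<exists>d\<in>D. d \<in> U))"
proof -
  obtain D :: "'a set" where D: "countable D" "closure D = UNIV"
    using assms by (auto simp: separable_space_def)
  have "\<exists>d\<in>D. d \<in> U" if "open U" "U \<noteq> {}" for U
    using open_Int_closure_eq_empty[OF that(1), of D] D(2) that(2) by auto
  with D(1) show ?thesis by (intro exI[of _ D] conjI allI impI)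
qed

text \<open>Two steps inside the set are taken because an open interval \<open>{x<..<z}\<close> meets \<open>D\<close> only if it
  is nonempty: the middle point \<open>y\<close> guarantees that.\<close>

lemma dense_cofinal_in_lower_set:
  fixes L D :: "'a::linorder_topology set"
  assumes dense: "\<And>U. open U \<Longrightarrow> U \<noteq> {} \<Longrightarrow> \<exists>d\<in>D. d \<in> U"
    and lower: "\<And>x y. y \<in> L \<Longrightarrow> x \<le> y \<Longrightarrow> x \<in> L"
    and no_max: "\<And>x. x \<in> L \<Longrightarrow> \<exists>y\<in>L. x < y"
    and "x \<in> L"
  shows "\<exists>d\<in>D \<inter> L. x < d"
proof -
  obtain y where y: "y \<in> L" "x < y" using no_max[OF \<open>x \<in> L\<close>] by blast
  obtain z where z: "z \<in> L" "y < z" using no_max[OF y(1)] by blast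
  obtain d where "d \<in> D" "d \<in> {x<..<z}"
    using dense[of "{x<..<z}", OF open_greaterThanLessThan] y z by fastforce
  then show ?thesis using lower[OF z(1), of d] by auto
qed

lemma dense_coinitial_in_upper_set:
  fixes S D :: "'a::linorder_topology set"
  assumes dense: "\<And>U. open U \<Longrightarrow> U \<noteq> {} \<Longrightarrow> \<exists>d\<in>D. d \<in> U"
    and upper: "\<And>x y. x \<in> S \<Longrightarrow> x \<le> y \<Longrightarrow> y \<in> S"
    and no_min: "\<And>x. x \<in> S \<Longrightarrow> \<exists>y\<in>S. y < x"
    and "x \<in> S"
  shows "\<exists>d\<in>D \<inter> S. d < x"
proof -
  obtain y where y: "y \<in> S" "y < x" using no_min[OF \<open>x \<in> S\<close>] by blast
  obtain z where z: "z \<in> S" "z < y" using no_min[OF y(1)] by blast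
  obtain d where "d \<in> D" "d \<in> {z<..<x}"
    using dense[of "{z<..<x}", OF open_greaterThanLessThan] y z by fastforce
  then show ?thesis using upper[OF z(1), of d] by auto
qed

section \<open>Half-lines generate the Borel sets of a separable linear order\<close>

lemma lower_set_in_sigma_atMost:
  fixes L D :: "'a::linorder_topology set"
  assumes "countable D" and dense: "\<And>U. open U \<Longrightarrow> U \<noteq> {} \<Longrightarrow> \<exists>d\<in>D. d \<in> U"
    and lower: "\<And>x y. y \<in> L \<Longrightarrow> x \<le> y \<Longrightarrow> x \<in> L"
  shows "L \<in> sigma_sets UNIV (range atMost)"
proof (cases "\<exists>m\<in>L. \<forall>x\<in>L. x \<le> m")
  case True
  then obtain m where "m \<in> L" "\<forall>x\<in>L. x \<le> m" by blast
  then have "L = {..m}" using lower by auto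
  then show ?thesis by auto
next
  case False
  then have no_max: "\<exists>y\<in>L. x < y" if "x \<in> L" for x using that by (meson not_le)
  have "\<exists>d\<in>D \<inter> L. x < d" if "x \<in> L" for x
    by (rule dense_cofinal_in_lower_set[of D L, OF dense lower no_max that])
  then have "L = (\<Union>d\<in>D \<inter> L. {..d})"
    using lower by (fastforce dest: less_imp_le)
  moreover have "(\<Union>d\<in>D \<inter> L. {..d}) \<in> sigma_sets UNIV (range atMost)"
    by (rule sigma_algebra.countable_UN'[OF sigma_algebra_sigma_sets])
       (use \<open>countable D\<close> in auto)
  ultimately show ?thesis by simp
qed

text \<open>An order-convex set is the difference of two lower sets: its downward closure, and the set of
  its strict lower bounds.\<close>

lemma order_convex_in_sigma_atMost:
  fixes C D :: "'a::linorder_topology set"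
  assumes "countable D" and dense: "\<And>U. open U \<Longrightarrow> U \<noteq> {} \<Longrightarrow> \<exists>d\<in>D. d \<in> U"
    and convex: "\<And>a b. a \<in> C \<Longrightarrow> b \<in> C \<Longrightarrow> {a..b} \<subseteq> C"
  shows "C \<in> sigma_sets UNIV (range atMost)"
proof -
  interpret sigma_algebra UNIV "sigma_sets UNIV (range (atMost :: 'a \<Rightarrow> 'a set))"
    by (rule sigma_algebra_sigma_sets) auto
  have "C = {x. \<exists>c\<in>C. x \<le> c} - {x. \<forall>c\<in>C. x < c}"
  proof (intro equalityI subsetI)
    fix x assume "x \<in> {x. \<exists>c\<in>C. x \<le> c} - {x. \<forall>c\<in>C. x < c}"
    then obtain a b where "a \<in> C" "a \<le> x" "b \<in> C" "x \<le> b" by (auto simp: not_less)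
    with convex[of a b] show "x \<in> C" by auto
  qed auto
  moreover have "{x. \<exists>c\<in>C. x \<le> c} \<in> sigma_sets UNIV (range atMost)"
    by (rule lower_set_in_sigma_atMost[of D, OF \<open>countable D\<close> dense]) (auto intro: order_trans)
  moreover have "{x. \<forall>c\<in>C. x < c} \<in> sigma_sets UNIV (range atMost)"
    by (rule lower_set_in_sigma_atMost[of D, OF \<open>countable D\<close> dense]) (auto intro: le_less_trans)
  ultimately show ?thesis by (metis Diff)
qed

lemma order_convex_open_neighbourhood:
  fixes U :: "'a::linorder_topology set"
  assumes "open U" "x \<in> U"
  shows "\<exists>I. open I \<and> x \<in> I \<and> I \<subseteq> U \<and> (\<forall>a\<in>I. \<forall>b\<in>I. {a..b} \<subseteq> I)"
  using assms unfolding open_generated_order[where 'a='a]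
proof (induction U rule: generate_topology.induct)
  case UNIV
  then show ?case by (intro exI[of _ UNIV]) (simp add: generate_topology.UNIV)
next
  case (Int U V)
  then obtain I J where
    "generate_topology (range lessThan \<union> range greaterThan) I" "x \<in> I" "I \<subseteq> U"
    "\<forall>a\<in>I. \<forall>b\<in>I. {a..b} \<subseteq> I"
    "generate_topology (range lessThan \<union> range greaterThan) J" "x \<in> J" "J \<subseteq> V"
    "\<forall>a\<in>J. \<forall>b\<in>J. {a..b} \<subseteq> J"
    by (metis IntD1 IntD2)
  then show ?case
    by (intro exI[of _ "I \<inter> J"]) (auto intro: generate_topology.Int)
next
  case (UN K)
  then obtain k where "k \<in> K" "x \<in> k" by auto
  with UN.IH[OF this] show ?case by (meson Union_upper subset_trans)
next
  case (Basis U)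
  then show ?case
    by (intro exI[of _ U]) (auto intro: generate_topology.Basis le_less_trans less_le_trans)
qed

text \<open>For \<open>d\<close> in \<open>U\<close>, the points that can be joined to \<open>d\<close> by an order interval inside \<open>U\<close> form the
  order-convex component of \<open>d\<close>. As every component is a neighbourhood of each of its points, the
  components of the points of \<open>D\<close> already cover \<open>U\<close>.\<close>

lemma open_in_sigma_atMost:
  fixes U D :: "'a::linorder_topology set"
  assumes "countable D" and dense: "\<And>U. open U \<Longrightarrow> U \<noteq> {} \<Longrightarrow> \<exists>d\<in>D. d \<in> U"
    and "open U"
  shows "U \<in> sigma_sets UNIV (range atMost)"
proof -
  define C where "C d = {x. {min x d..max x d} \<subseteq> U}" for d
  have "U = (\<Union>d\<in>D. C d)"
  proof (intro equalityI subsetI)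
    fix x assume "x \<in> U"
    from order_convex_open_neighbourhood[OF \<open>open U\<close> this]
    obtain I where I: "open I" "x \<in> I" "I \<subseteq> U" "\<forall>a\<in>I. \<forall>b\<in>I. {a..b} \<subseteq> I" by blast
    then obtain d where "d \<in> D" "d \<in> I" using dense[of I] by blast
    with I have "x \<in> C d" by (auto simp: C_def min_def max_def)
    with \<open>d \<in> D\<close> show "x \<in> (\<Union>d\<in>D. C d)" by blast
  next
    fix x assume "x \<in> (\<Union>d\<in>D. C d)"
    then obtain d where "{min x d..max x d} \<subseteq> U" by (auto simp: C_def)
    moreover have "x \<in> {min x d..max x d}" by simp
    ultimately show "x \<in> U" by blast
  qed
  moreover have "C d \<in> sigma_sets UNIV (range atMost)" for d
  proof (rule order_convex_in_sigma_atMost[of D, OF \<open>countable D\<close> dense])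
    fix a b assume ab: "a \<in> C d" "b \<in> C d"
    show "{a..b} \<subseteq> C d"
    proof
      fix x assume "x \<in> {a..b}"
      then have "{min x d..max x d} \<subseteq> {min a d..max a d} \<union> {min b d..max b d}"
        by (auto simp: min_def max_def)
      with ab show "x \<in> C d" unfolding C_def by blast
    qed
  qed
  then have "(\<Union>d\<in>D. C d) \<in> sigma_sets UNIV (range atMost)"
    by (intro sigma_algebra.countable_UN'[OF sigma_algebra_sigma_sets])
       (use \<open>countable D\<close> in auto)
  ultimately show ?thesis by simp
qed

lemma sets_borel_eq_sigma_atMost:
  assumes "separable_space (euclidean :: 'a::linorder_topology topology)"
  shows "sets (borel :: 'a measure) = sigma_sets UNIV (range atMost)"
proof -
  obtain D :: "'a set"
    where D: "countable D" "\<forall>U. open U \<longrightarrow> U \<noteq> {} \<longrightarrow> (\<exists>d\<in>D. d \<in> U)"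
    using separable_space_countable_dense[OF assms] by (elim exE conjE) (rule that)
  have "sigma_sets UNIV {S::'a set. open S} = sigma_sets UNIV (range atMost)"
  proof (rule sigma_sets_eqI)
    fix S :: "'a set" assume "S \<in> {S. open S}"
    then show "S \<in> sigma_sets UNIV (range atMost)"
      using open_in_sigma_atMost[of D, OF D(1) D(2)[rule_format]] by simp
  next
    fix B :: "'a set" assume "B \<in> range atMost"
    then have "B \<in> sets borel" by auto
    then show "B \<in> sigma_sets UNIV {S. open S}" by (simp add: borel_def)
  qed
  then show ?thesis by (simp add: borel_def)
qed

section \<open>The pseudo-inverse as a lower adjoint\<close>

lemma isGlb_UNIV_iff:
  "isGlb UNIV S g \<longleftrightarrow> (\<forall>y\<in>S. g \<le> y) \<and> (\<forall>z. (\<forall>y\<in>S. z \<le> y) \<longrightarrow> z \<le> g)"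
  unfolding isGlb_def greatestP_def isLb_def setge_def setle_def by simp

lemma pseudo_inverse_isGlb:
  assumes "pseudo_inverse \<mu> r = Some g"
  shows "isGlb UNIV {y. r \<le> order_cdf \<mu> y} g"
proof -
  have "\<exists>h. isGlb UNIV {y. r \<le> order_cdf \<mu> y} h"
    using assms unfolding pseudo_inverse_def by (metis option.distinct(1))
  then obtain h where h: "isGlb UNIV {y. r \<le> order_cdf \<mu> y} h" ..
  have "g = (THE g. isGlb UNIV {y. r \<le> order_cdf \<mu> y} g)"
    using assms unfolding pseudo_inverse_def by (metis option.distinct(1) option.inject)
  also have "\<dots> = h"
    using h isGlb_unique[OF _ h] by (rule the_equality)
  finally show ?thesis using h by simp
qed

lemma order_cdf_mono:
  assumes "finite_measure \<mu>" "sets \<mu> = sets borel" "x \<le> y"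
  shows "order_cdf \<mu> x \<le> order_cdf \<mu> y"
proof -
  interpret finite_measure \<mu> by fact
  have "{..y} \<in> sets \<mu>" unfolding assms(2) by simp
  then show ?thesis unfolding order_cdf_def
    using assms(3) by (intro finite_measure_mono) (auto simp: atMost_def)
qed

text \<open>This is right-continuity of the distribution function. If the infimum \<open>g\<close> were outside
  \<open>S = {y. F y \<ge> r}\<close>, then \<open>S\<close> would have no least element, and \<open>{..g}\<close> would be the decreasing limit
  of finite intersections of half-lines with endpoints in the countable set \<open>D \<inter> S\<close>. When \<open>S\<close> is
  empty its infimum is the greatest point of the order, where \<open>F\<close> is 1.\<close>

lemma order_cdf_infimum_ge:
  fixes \<mu> :: "'a::linorder_topology measure"
  assumes separable: "separable_space (euclidean :: 'a topology)"
    and prob: "prob_space \<mu>" and sets: "sets \<mu> = sets borel"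
    and "r \<le> 1" and glb: "isGlb UNIV {y. r \<le> order_cdf \<mu> y} g"
  shows "r \<le> order_cdf \<mu> g"
proof (rule ccontr)
  assume g_notin: "\<not> r \<le> order_cdf \<mu> g"
  interpret prob_space \<mu> by fact
  have space: "space \<mu> = UNIV" using sets_eq_imp_space_eq[OF sets] by simp
  have atMost_sets: "{..x} \<in> sets \<mu>" for x unfolding sets by simp
  define S where "S = {y. r \<le> order_cdf \<mu> y}"
  have lower_bound: "g \<le> y" if "y \<in> S" for y
    using glb that unfolding isGlb_UNIV_iff S_def by blast
  have greatest: "z \<le> g" if "\<And>y. y \<in> S \<Longrightarrow> z \<le> y" for z
    using glb that unfolding isGlb_UNIV_iff S_def by blast
  have upper: "y \<in> S" if "x \<in> S" "x \<le> y" for x y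
    using that order_cdf_mono[OF finite_measure_axioms sets, of x y] by (auto simp: S_def)
  have no_min: "\<exists>y\<in>S. y < x" if "x \<in> S" for x
  proof (rule ccontr)
    assume "\<not> ?thesis"
    then have "x \<le> g" by (intro greatest) (auto simp: not_less)
    with lower_bound[OF that] that g_notin show False by (simp add: S_def)
  qed
  have "S \<noteq> {}"
  proof
    assume "S = {}"
    then have "{y. y \<le> g} = space \<mu>" using greatest space by auto
    then have "order_cdf \<mu> g = 1" by (simp add: order_cdf_def prob_space)
    with g_notin \<open>r \<le> 1\<close> show False by simp
  qed
  obtain D :: "'a set"
    where D: "countable D" "\<forall>U. open U \<longrightarrow> U \<noteq> {} \<longrightarrow> (\<exists>d\<in>D. d \<in> U)"
    using separable_space_countable_dense[OF separable] by (elim exE conjE) (rule that)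
  have coinitial: "\<exists>d\<in>D \<inter> S. d < x" if "x \<in> S" for x
    by (rule dense_coinitial_in_upper_set[of D S, OF D(2)[rule_format] upper no_min that])
  have nonempty: "D \<inter> S \<noteq> {}" using coinitial \<open>S \<noteq> {}\<close> by blast
  define e where "e = from_nat_into (D \<inter> S)"
  have range_e: "range e = D \<inter> S"
    unfolding e_def using nonempty D(1) by (intro range_from_nat_into) auto
  define B where "B n = (\<Inter>i\<le>n. {..e i})" for n
  have B_eq: "B n = {..Min (e ` {..n})}" for n
    by (auto simp: B_def)
  have "(\<Inter>n. B n) = {..g}"
  proof (intro equalityI subsetI)
    fix x assume "x \<in> (\<Inter>n. B n)"
    then have below: "x \<le> d" if "d \<in> D \<inter> S" for d
      using that unfolding range_e[symmetric] by (auto simp: B_def)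
    have "x \<le> g"
    proof (rule greatest)
      fix y assume "y \<in> S"
      then obtain d where "d \<in> D \<inter> S" "d < y" using coinitial by blast
      with below show "x \<le> y" by fastforce
    qed
    then show "x \<in> {..g}" by simp
  next
    fix x assume "x \<in> {..g}"
    moreover have "g \<le> e i" for i using range_e lower_bound by blast
    ultimately show "x \<in> (\<Inter>n. B n)" by (auto simp: B_def intro: order_trans)
  qed
  moreover have "(\<lambda>n. measure \<mu> (B n)) \<longlonglongrightarrow> measure \<mu> (\<Inter>n. B n)"
  proof (rule finite_Lim_measure_decseq)
    show "range B \<subseteq> sets \<mu>" using atMost_sets by (auto simp: B_eq)
    show "decseq B" by (auto simp: decseq_def B_def)
  qed
  moreover have "r \<le> measure \<mu> (B n)" for n
  proof -
    have "Min (e ` {..n}) \<in> e ` {..n}" by (intro Min_in) auto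
    then have "Min (e ` {..n}) \<in> S" using range_e by blast
    then show ?thesis by (simp add: B_eq S_def order_cdf_def atMost_def)
  qed
  ultimately have "r \<le> measure \<mu> {..g}"
    by (metis LIMSEQ_le_const)
  with g_notin show False by (simp add: order_cdf_def atMost_def)
qed

lemma pseudo_inverse_le_iff:
  fixes \<mu> :: "'a::linorder_topology measure"
  assumes separable: "separable_space (euclidean :: 'a topology)"
    and prob: "prob_space \<mu>" and sets: "sets \<mu> = sets borel"
    and g: "pseudo_inverse \<mu> r = Some g"
  shows "g \<le> x \<longleftrightarrow> r \<le> order_cdf \<mu> x"
proof
  interpret prob_space \<mu> by fact
  have "r \<le> 1" using g by (auto simp: pseudo_inverse_def split: if_splits)
  then have "r \<le> order_cdf \<mu> g"
    using order_cdf_infimum_ge[OF separable prob sets _ pseudo_inverse_isGlb[OF g]] by simp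
  moreover assume "g \<le> x"
  ultimately show "r \<le> order_cdf \<mu> x"
    using order_cdf_mono[OF finite_measure_axioms sets] order_trans by blast
next
  assume "r \<le> order_cdf \<mu> x"
  with pseudo_inverse_isGlb[OF g] show "g \<le> x"
    unfolding isGlb_UNIV_iff by blast
qed

section \<open>The image of Lebesgue measure\<close>

theorem proposition7p5:
  fixes \<mu> :: "'a::linorder_topology measure"
  assumes "separable_space (euclidean :: 'a topology)"
    and "prob_space \<mu>"
    and "sets \<mu> = sets borel"
    and "dom (pseudo_inverse \<mu>) = {0..1}"
  shows "\<forall>A \<in> sets borel.
           pseudo_inverse \<mu> -` (Some ` A) \<in> sets (lebesgue_on {0..1}) \<and>
           emeasure \<mu> A = emeasure (lebesgue_on {0..1}) (pseudo_inverse \<mu> -` (Some ` A))"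
proof -
  interpret prob_space \<mu> by fact
  let ?l = "lebesgue_on {0..1::real}"
  define G where "G r = the (pseudo_inverse \<mu> r)" for r
  have G: "pseudo_inverse \<mu> r = Some (G r)" if "r \<in> {0..1}" for r
    using that assms(4) unfolding G_def by (metis domD option.sel)
  have vimage_G: "pseudo_inverse \<mu> -` (Some ` A) = G -` A \<inter> {0..1}" for A
  proof -
    have "r \<in> {0..1}" if "pseudo_inverse \<mu> r = Some a" for r a
      using that assms(4) by blast
    then show ?thesis using G by (fastforce simp: G_def)
  qed
  have cdf_bounds: "0 \<le> order_cdf \<mu> x" "order_cdf \<mu> x \<le> 1" for x
    by (simp_all add: order_cdf_def)
  have vimage_atMost: "G -` {..x} \<inter> {0..1} = {0..order_cdf \<mu> x}" for x
    using pseudo_inverse_le_iff[OF assms(1-3) G, of _ x] cdf_bounds[of x] by auto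
  have interval: "{0..order_cdf \<mu> x} \<in> sets ?l"
    "emeasure ?l {0..order_cdf \<mu> x} = order_cdf \<mu> x" for x
    using cdf_bounds[of x]
    by (auto simp: sets_restrict_space_iff emeasure_restrict_space)
  have borel_eq: "sets (borel :: 'a measure) = sigma_sets UNIV (range atMost)"
    by (rule sets_borel_eq_sigma_atMost) fact
  have measurable_G: "G \<in> measurable ?l borel"
    by (rule measurable_sigma_sets[OF borel_eq])
       (auto simp: vimage_atMost interval)
  \<comment> \<open>The whole space joins the generator because the order may have no greatest element, while the
    uniqueness theorem wants it exhausted by sets of finite measure.\<close>
  let ?E = "insert UNIV (range (atMost :: 'a \<Rightarrow> 'a set))"
  have borel_eq': "sets (borel :: 'a measure) = sigma_sets UNIV ?E"
    unfolding borel_eq by (rule sigma_sets_eqI) (auto intro: sigma_sets_top)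
  have "\<mu> = distr ?l borel G"
  proof (rule measure_eqI_generator_eq[where E = ?E and \<Omega> = UNIV and A = "\<lambda>_. UNIV"])
    show "Int_stable ?E" by (auto simp: Int_stable_def)
    show "emeasure \<mu> X = emeasure (distr ?l borel G) X" if "X \<in> ?E" for X
      using that
    proof
      assume "X = UNIV"
      moreover have "emeasure \<mu> UNIV = 1"
        using emeasure_space_1 sets_eq_imp_space_eq[OF assms(3)] by simp
      ultimately show ?thesis
        by (simp add: emeasure_distr[OF measurable_G] space_restrict_space emeasure_restrict_space)
    next
      assume "X \<in> range atMost"
      then obtain x where "X = {..x}" by auto
      then show ?thesis
        by (simp add: emeasure_distr[OF measurable_G] vimage_atMost interval emeasure_eq_measure)
          (simp add: order_cdf_def atMost_def)
    qed
  qed (use assms(3) borel_eq' in auto)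
  then have "emeasure \<mu> A = emeasure ?l (G -` A \<inter> {0..1})" if "A \<in> sets borel" for A
    using emeasure_distr[OF measurable_G that] by (simp add: space_restrict_space)
  moreover have "G -` A \<inter> {0..1} \<in> sets ?l" if "A \<in> sets borel" for A
    using measurable_sets[OF measurable_G that] by (simp add: space_restrict_space)
  ultimately show ?thesis by (simp add: vimage_G)
qed

end
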